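(* Let $p$ be a prime and let $\nu$ be a positive integer. Let $A$ be a finite abelian group of exponent $N$. Let $r_{I'}$ be the number of $p^{2\nu}$-cyclotomic classes of $A$ of type $I'$ and $2r_{II'}$ the number of those of type $II'$. If $p\nmid N$, then $$r_{I'}+r_{II'}=\sum_{d\mid N}\lambda(d,p^\nu)\frac{\mathcal{N}_A(d)}{\mathrm{ord}_d(p^{2\nu})}+\frac12\sum_{d\mid N}\left(1-\lambda(d,p^\nu)\right)\frac{\mathcal{N}_A(d)}{\mathrm{ord}_d(p^{2\nu})},$$ where $\mathcal{N}_A(d)$ denotes the number of elements of order $d$ in $A$.
   Context: For $a\in A$ (written additively), $S_{p^{2\nu}}(a)=\{p^{2\nu i}\cdot a : i\ge 0\}$ is the $p^{2\nu}$-cyclotomic class of $a$ (these classes partition $A$ when $p\nmid |A|$); it is of type $I'$ if $S_{p^{2\nu}}(a)=S_{p^{2\nu}}(-p^\nu a)$ and of type $II'$ otherwise. Classes of type $II'$ come in pairs $S_{p^{2\nu}}(a)\ne S_{p^{2\nu}}(-p^\nu a)$. $\mathrm{ord}_d(m)$ denotes the multiplicative order of $m$ modulo $d$ (equal to $1$ for $d=1$). $\lambda(d,p^\nu)=1$ if there exists an odd positive integer $i$ such that $d\mid (p^{\nu i}+1)$, and $\lambda(d,p^\nu)=0$ otherwise. *)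

theory Defs
  imports
    Complex_Main
    "HOL-Algebra.Multiplicative_Group"
    "HOL-Number_Theory.Pocklington"
begin

text \<open>
  The abelian group is a multiplicatively written \<open>comm_group\<close> of HOL-Algebra, so the
  additive multiple \<open>m \<cdot> a\<close> appears as the power of \<open>a\<close> with exponent \<open>m\<close>, and
  \<open>- a\<close> as the inverse of \<open>a\<close>.
\<close>

definition group_exponent :: "('a, 'b) monoid_scheme \<Rightarrow> nat" where
  "group_exponent A = (LEAST n. 0 < n \<and> (\<forall>a\<in>carrier A. a [^]\<^bsub>A\<^esub> n = \<one>\<^bsub>A\<^esub>))"

definition elements_of_order :: "('a, 'b) monoid_scheme \<Rightarrow> nat \<Rightarrow> 'a set" where
  "elements_of_order A d = {a \<in> carrier A. group.ord A a = d}"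

definition cyclotomic_class :: "('a, 'b) monoid_scheme \<Rightarrow> nat \<Rightarrow> 'a \<Rightarrow> 'a set" where
  "cyclotomic_class A q a = {a [^]\<^bsub>A\<^esub> (q ^ i) | i::nat. True}"

definition cyclotomic_classes :: "('a, 'b) monoid_scheme \<Rightarrow> nat \<Rightarrow> 'a set set" where
  "cyclotomic_classes A q = {cyclotomic_class A q a | a. a \<in> carrier A}"

definition classes_type_I' :: "('a, 'b) monoid_scheme \<Rightarrow> nat \<Rightarrow> nat \<Rightarrow> 'a set set" where
  "classes_type_I' A p \<nu> =
     {cyclotomic_class A (p ^ (2 * \<nu>)) a | a.
        a \<in> carrier A \<and>
        cyclotomic_class A (p ^ (2 * \<nu>)) a =
        cyclotomic_class A (p ^ (2 * \<nu>)) (inv\<^bsub>A\<^esub> (a [^]\<^bsub>A\<^esub> (p ^ \<nu>)))}"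

definition classes_type_II' :: "('a, 'b) monoid_scheme \<Rightarrow> nat \<Rightarrow> nat \<Rightarrow> 'a set set" where
  "classes_type_II' A p \<nu> = cyclotomic_classes A (p ^ (2 * \<nu>)) - classes_type_I' A p \<nu>"

definition lambda :: "nat \<Rightarrow> nat \<Rightarrow> real" where
  "lambda d q = (if \<exists>i::nat. 0 < i \<and> odd i \<and> d dvd q ^ i + 1 then 1 else 0)"

end

theory Submission
  imports Defs
begin

text \<open>
  Write \<open>q = p ^ \<nu>\<close>. The \<open>q\<^sup>2\<close>-cyclotomic class of an element of order \<open>d\<close> has
  \<open>ord\<^sub>d(q\<^sup>2)\<close> elements, and it is of type \<open>I'\<close> iff \<open>-q \<equiv> q ^ (2 * i)\<close> modulo \<open>d\<close> for some
  \<open>i\<close>; cancelling \<open>q\<close>, this says \<open>\<lambda>(d, q) = 1\<close>. As the classes partition the group, the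
  number of classes in a union \<open>S\<close> of classes is the sum over \<open>a \<in> S\<close> of the reciprocal of
  the size of the class of \<open>a\<close>, and it remains to group the summands by the order of \<open>a\<close>.
\<close>

text \<open>The hypotheses make the sets \<open>f a\<close> a partition of \<open>S\<close>. The
  fibre of \<open>f\<close> over a class \<open>C\<close> is then \<open>C\<close> itself, so its
  \<open>card C\<close> equal summands \<open>1 / card C\<close> add up to 1.\<close>

lemma card_image_eq_sum_inverse_card:
  fixes f :: "'a \<Rightarrow> 'a set"
  assumes "finite S"
    and refl: "\<And>a. a \<in> S \<Longrightarrow> a \<in> f a"
    and closed: "\<And>a. a \<in> S \<Longrightarrow> f a \<subseteq> S"
    and eq: "\<And>a b. a \<in> S \<Longrightarrow> b \<in> f a \<Longrightarrow> f b = f a"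
  shows "real (card (f ` S)) = (\<Sum>a\<in>S. 1 / real (card (f a)))"
proof -
  have "(\<Sum>a\<in>S. 1 / real (card (f a))) = (\<Sum>C\<in>f ` S. \<Sum>a | a \<in> S \<and> f a = C. 1 / real (card (f a)))"
    using \<open>finite S\<close> by (rule sum.image_gen)
  also have "\<dots> = (\<Sum>C\<in>f ` S. 1)"
  proof (intro sum.cong HOL.refl)
    fix C assume "C \<in> f ` S"
    then obtain b where b: "b \<in> S" "C = f b" by blast
    have "C \<subseteq> S" "C \<noteq> {}" "finite C"
      using b refl[of b] closed[of b] \<open>finite S\<close> by (auto intro: finite_subset)
    moreover have fC: "f a = C" if "a \<in> C" for a
      using b eq[of b a] that by simp
    ultimately have "{a \<in> S. f a = C} = C"
      using refl by auto
    then show "(\<Sum>a | a \<in> S \<and> f a = C. 1 / real (card (f a))) = 1"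
      using fC \<open>finite C\<close> \<open>C \<noteq> {}\<close> by simp
  qed
  finally show ?thesis by simp
qed

context group
begin

lemma nat_pow_eq_iff_cong:
  assumes "x \<in> carrier G"
  shows "x [^] (m::nat) = x [^] (n::nat) \<longleftrightarrow> [m = n] (mod ord x)"
  using int_pow_eq[OF assms, of "int m" "int n"]
  by (simp add: int_pow_int cong_iff_dvd_diff dvd_diff_commute flip: cong_int_iff)

text \<open>Serves to turn the condition on inverses that defines type I' into a divisibility
  between natural numbers.\<close>

lemma inv_nat_pow_eq_iff_dvd:
  assumes "x \<in> carrier G"
  shows "inv (x [^] (m::nat)) = x [^] (n::nat) \<longleftrightarrow> ord x dvd m + n"
  proof -
  have "inv (x [^] m) = x [^] n \<longleftrightarrow> x [^] m \<otimes> x [^] n = \<one>"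
    using assms by (metis inv_equality inv_inv nat_pow_closed r_inv)
  then show ?thesis
    using assms by (simp add: nat_pow_mult pow_eq_id)
qed

lemma ord_nat_pow_coprime:
  assumes "x \<in> carrier G" "coprime (ord x) k"
  shows "ord (x [^] k) = ord x"
  using assms by (simp add: ord_unique nat_pow_pow pow_eq_id coprime_dvd_mult_right_iff)

lemma cyclotomic_class_refl:
  assumes "x \<in> carrier G"
  shows "x \<in> cyclotomic_class G q x"
  unfolding cyclotomic_class_def using assms by (auto intro: exI[of _ 0])

lemma cyclotomic_class_subset_carrier:
  assumes "x \<in> carrier G"
  shows "cyclotomic_class G q x \<subseteq> carrier G"
  unfolding cyclotomic_class_def using assms by auto

lemma ord_cyclotomic_class:
  assumes "x \<in> carrier G" "coprime (ord x) q" "y \<in> cyclotomic_class G q x"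
  shows "ord y = ord x"
  using assms ord_nat_pow_coprime by (auto simp: cyclotomic_class_def)

lemma cyclotomic_class_subset:
  assumes "x \<in> carrier G" "y \<in> cyclotomic_class G q x"
  shows "cyclotomic_class G q y \<subseteq> cyclotomic_class G q x"
  using assms by (auto simp: cyclotomic_class_def nat_pow_pow simp flip: power_add)

text \<open>Coprimality makes \<open>q\<close> invertible modulo \<open>ord x\<close>, so raising to
  the power \<open>q ^ i\<close> is undone by a further power of \<open>q\<close>.\<close>

lemma cyclotomic_class_sym:
  assumes x: "x \<in> carrier G" and co: "coprime (ord x) q" and "y \<in> cyclotomic_class G q x"
  shows "x \<in> cyclotomic_class G q y"
proof -
  obtain i where y: "y = x [^] (q ^ i)"
    using assms(3) by (auto simp: cyclotomic_class_def)
  let ?o = "Pocklington.ord (ord x) q"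
  have "?o > 0"
    using co Pocklington.ord_eq_0 by blast
  \<comment> \<open>The multiple \<open>i * ?o\<close> of the order is at least \<open>i\<close>, so
    the subtraction in the exponent \<open>i * ?o - i\<close> below does not truncate.\<close>
  then have "i \<le> i * ?o" by (cases ?o) auto
  have "[q ^ (i * ?o) = 1] (mod ord x)"
    by (simp only: ord_divides dvd_triv_right)
  then have "x [^] (q ^ (i * ?o)) = x"
    using nat_pow_eq_iff_cong[OF x, of _ 1] x by simp
  then have "y [^] (q ^ (i * ?o - i)) = x"
    using x \<open>i \<le> i * ?o\<close> by (simp add: y nat_pow_pow flip: power_add)
  then show ?thesis
    unfolding cyclotomic_class_def by (metis (mono_tags) mem_Collect_eq)
qed

lemma cyclotomic_class_eq_iff:
  assumes "x \<in> carrier G" "coprime (ord x) q" "y \<in> carrier G"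
  shows "cyclotomic_class G q x = cyclotomic_class G q y \<longleftrightarrow> y \<in> cyclotomic_class G q x"
  using assms cyclotomic_class_refl cyclotomic_class_sym cyclotomic_class_subset
  by (metis subset_antisym)

text \<open>The element \<open>x [^] (q ^ i)\<close> determines \<open>i\<close> exactly modulo the
  order of \<open>q\<close> modulo \<open>ord x\<close>, so the exponents below that order list the
  class without repetition.\<close>

lemma card_cyclotomic_class:
  assumes x: "x \<in> carrier G" and co: "coprime (ord x) q"
  shows "card (cyclotomic_class G q x) = Pocklington.ord (ord x) q"
proof -
  let ?o = "Pocklington.ord (ord x) q"
  have "?o > 0"
    using co Pocklington.ord_eq_0 by blast
  have eq: "x [^] (q ^ i) = x [^] (q ^ j) \<longleftrightarrow> [i = j] (mod ?o)" for i j
    using nat_pow_eq_iff_cong[OF x] order_divides_expdiff[OF co] by simp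
  have "bij_betw (\<lambda>i. x [^] (q ^ i)) {..<?o} (cyclotomic_class G q x)"
  proof (rule bij_betw_imageI)
    show "inj_on (\<lambda>i. x [^] (q ^ i)) {..<?o}"
      using eq cong_less_modulus_unique_nat by (auto simp: inj_on_def)
    have "x [^] (q ^ i) \<in> (\<lambda>i. x [^] (q ^ i)) ` {..<?o}" for i
      using eq[of i "i mod ?o"] \<open>?o > 0\<close> by (intro image_eqI[of _ _ "i mod ?o"]) auto
    then show "(\<lambda>i. x [^] (q ^ i)) ` {..<?o} = cyclotomic_class G q x"
      by (auto simp: cyclotomic_class_def)
  qed
  then show ?thesis
    using bij_betw_same_card by fastforce
qed

lemma inv_nat_pow_mem_cyclotomic_class_iff:
  assumes x: "x \<in> carrier G" and co: "coprime (ord x) q"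
  shows "inv (x [^] q) \<in> cyclotomic_class G (q ^ 2) x \<longleftrightarrow>
    (\<exists>i::nat. 0 < i \<and> odd i \<and> ord x dvd q ^ i + 1)"
proof -
  have "inv (x [^] q) \<in> cyclotomic_class G (q ^ 2) x \<longleftrightarrow> (\<exists>i. ord x dvd q + q ^ (2 * i))"
    using inv_nat_pow_eq_iff_dvd[OF x]
    by (auto simp: cyclotomic_class_def power_mult)
  also have "\<dots> \<longleftrightarrow> (\<exists>i::nat. 0 < i \<and> odd i \<and> ord x dvd q ^ i + 1)"
  proof
    assume "\<exists>i. ord x dvd q + q ^ (2 * i)"
    then obtain i where i: "ord x dvd q + q ^ (2 * i)" by blast
    show "\<exists>i::nat. 0 < i \<and> odd i \<and> ord x dvd q ^ i + 1"
    proof (cases i)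
      \<comment> \<open>Here the divisibility reads \<open>ord x dvd q + 1\<close>, which is the odd
        exponent 1 with nothing to cancel.\<close>
      case 0
      with i show ?thesis by (intro exI[of _ 1]) simp
    next
      case (Suc k)
      with i have "ord x dvd q * (q ^ (2 * k + 1) + 1)"
        by (simp add: algebra_simps)
      then have "ord x dvd q ^ (2 * k + 1) + 1"
        using co coprime_dvd_mult_right_iff by blast
      then show ?thesis by (intro exI[of _ "2 * k + 1"]) simp
    qed
  next
    assume "\<exists>i::nat. 0 < i \<and> odd i \<and> ord x dvd q ^ i + 1"
    then obtain k where "ord x dvd q ^ (2 * k + 1) + 1"
      by (auto elim: oddE)
    \<comment> \<open>Multiplying by \<open>q\<close> makes the odd exponent even: the product is
      \<open>q + q ^ (2 * Suc k)\<close>.\<close>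
    then have "ord x dvd q * (q ^ (2 * k + 1) + 1)"
      by (rule dvd_mult)
    then show "\<exists>i. ord x dvd q + q ^ (2 * i)"
      by (intro exI[of _ "Suc k"]) (simp add: algebra_simps)
  qed
  finally show ?thesis .
qed

lemma group_exponent_props:
  assumes "finite (carrier G)"
  shows "0 < group_exponent G \<and> (\<forall>x\<in>carrier G. x [^] group_exponent G = \<one>)"
  unfolding group_exponent_def
proof (rule LeastI)
  \<comment> \<open>By Lagrange the group order is a candidate for the least exponent; it is
    positive because the group is finite.\<close>
  show "0 < order G \<and> (\<forall>x\<in>carrier G. x [^] order G = \<one>)"
    using assms pow_order_eq_1 order_gt_0_iff_finite by blast
qed

lemma ord_dvd_group_exponent:
  assumes "finite (carrier G)" "x \<in> carrier G"
  shows "ord x dvd group_exponent G"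
  using group_exponent_props assms pow_eq_id by blast

text \<open>All elements of a class have the same order, so a condition \<open>P\<close> on the
  order cuts out a union of classes. Using \<open>P\<close> and its negation counts both
  types.\<close>

lemma card_cyclotomic_classes_by_order:
  assumes fin: "finite (carrier G)" and co: "coprime (group_exponent G) q"
  shows "real (card (cyclotomic_class G q ` {x \<in> carrier G. P (ord x)})) =
    (\<Sum>d | d dvd group_exponent G. of_bool (P d) *
      (real (card (elements_of_order G d)) / real (Pocklington.ord d q)))"
proof -
  let ?S = "{x \<in> carrier G. P (ord x)}" and ?D = "{d. d dvd group_exponent G}"
  have co: "coprime (ord x) q" if "x \<in> carrier G" for x
    using that ord_dvd_group_exponent[OF fin] co coprime_divisors dvd_refl by blast
  have "real (card (cyclotomic_class G q ` ?S)) =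
      (\<Sum>x\<in>?S. 1 / real (card (cyclotomic_class G q x)))"
  proof (rule card_image_eq_sum_inverse_card)
    fix x assume x: "x \<in> ?S"
    then show "x \<in> cyclotomic_class G q x"
      using cyclotomic_class_refl by blast
    show sub: "cyclotomic_class G q x \<subseteq> ?S"
      using x cyclotomic_class_subset_carrier[of x q] ord_cyclotomic_class[of x q] co[of x] by auto
    show "cyclotomic_class G q y = cyclotomic_class G q x" if "y \<in> cyclotomic_class G q x" for y
      using cyclotomic_class_eq_iff[of x q y] x co[of x] that sub by auto
  qed (use fin in simp)
  also have "\<dots> = (\<Sum>x\<in>?S. 1 / real (Pocklington.ord (ord x) q))"
    using co by (intro sum.cong) (auto simp: card_cyclotomic_class)
  \<comment> \<open>Grouping is possible because every order lies in \<open>?D\<close>, which is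
    finite since the exponent is positive.\<close>
  also have "\<dots> = (\<Sum>d\<in>?D. \<Sum>x | x \<in> ?S \<and> ord x = d. 1 / real (Pocklington.ord (ord x) q))"
    using fin group_exponent_props[OF fin] ord_dvd_group_exponent[OF fin]
    by (intro sum.group[symmetric]) auto
  also have "\<dots> = (\<Sum>d\<in>?D. of_bool (P d) *
      (real (card (elements_of_order G d)) / real (Pocklington.ord d q)))"
  proof (intro sum.cong HOL.refl)
    fix d
    have "{x. x \<in> ?S \<and> ord x = d} = (if P d then elements_of_order G d else {})"
      by (auto simp: elements_of_order_def)
    moreover have "(\<Sum>x | x \<in> ?S \<and> ord x = d. 1 / real (Pocklington.ord (ord x) q)) =
        (\<Sum>x | x \<in> ?S \<and> ord x = d. 1 / real (Pocklington.ord d q))"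
      by (intro sum.cong) auto
    ultimately show "(\<Sum>x | x \<in> ?S \<and> ord x = d. 1 / real (Pocklington.ord (ord x) q)) =
        of_bool (P d) * (real (card (elements_of_order G d)) / real (Pocklington.ord d q))"
      by simp
  qed
  finally show ?thesis .
qed

end

theorem proposition5p5:
  fixes A :: "('a, 'b) monoid_scheme"
    and p \<nu> N :: nat
    and r_I' r_II' :: real
  assumes "prime p"
    and "0 < \<nu>"
    and "comm_group A"
    and "finite (carrier A)"
    and "N = group_exponent A"
    and "r_I' = real (card (classes_type_I' A p \<nu>))"
    and "2 * r_II' = real (card (classes_type_II' A p \<nu>))"
    and "\<not> p dvd N"
  shows "r_I' + r_II' =
      (\<Sum>d | d dvd N. lambda d (p ^ \<nu>) *
          (real (card (elements_of_order A d)) / real (ord d (p ^ (2 * \<nu>)))))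
    + 1 / 2 * (\<Sum>d | d dvd N. (1 - lambda d (p ^ \<nu>)) *
          (real (card (elements_of_order A d)) / real (ord d (p ^ (2 * \<nu>)))))"
proof -
  interpret A: group A
    using \<open>comm_group A\<close> by (simp add: comm_group_def)
  define q where "q = p ^ \<nu>"
  define P where "P d \<longleftrightarrow> (\<exists>i::nat. 0 < i \<and> odd i \<and> d dvd q ^ i + 1)" for d
  have Q: "p ^ (2 * \<nu>) = q ^ 2"
    by (simp add: q_def mult.commute flip: power_mult)
  have lam: "lambda d q = of_bool (P d)" for d
    by (simp add: lambda_def P_def)
  have coN: "coprime N q"
    using prime_imp_coprime[OF assms(1,8)] by (simp add: q_def coprime_commute[of N])
  then have coN2: "coprime (group_exponent A) (q ^ 2)"
    using assms(5) by simp
  have co: "coprime (A.ord x) q" if "x \<in> carrier A" for x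
    using that A.ord_dvd_group_exponent[OF assms(4)] coN assms(5) coprime_divisors dvd_refl by blast
  have type_I': "cyclotomic_class A (q ^ 2) x = cyclotomic_class A (q ^ 2) (inv\<^bsub>A\<^esub> (x [^]\<^bsub>A\<^esub> q)) \<longleftrightarrow>
      P (A.ord x)" if "x \<in> carrier A" for x
    using that co[OF that] A.cyclotomic_class_eq_iff[of x "q ^ 2" "inv\<^bsub>A\<^esub> (x [^]\<^bsub>A\<^esub> q)"]
      A.inv_nat_pow_mem_cyclotomic_class_iff[of x q]
    by (simp add: P_def)
  have I': "classes_type_I' A p \<nu> = cyclotomic_class A (q ^ 2) ` {x \<in> carrier A. P (A.ord x)}"
    unfolding classes_type_I'_def Q using type_I' by (auto simp flip: q_def)
  have II': "classes_type_II' A p \<nu> = cyclotomic_class A (q ^ 2) ` {x \<in> carrier A. \<not> P (A.ord x)}"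
  proof -
    \<comment> \<open>Whether \<open>P\<close> holds depends on the class and not on its
      representative, so removing the type I' classes leaves exactly the image of the
      complement.\<close>
    have "P (A.ord x) \<longleftrightarrow> P (A.ord y)"
      if "x \<in> carrier A" "y \<in> carrier A"
        "cyclotomic_class A (q ^ 2) x = cyclotomic_class A (q ^ 2) y" for x y
      using that co A.cyclotomic_class_refl A.ord_cyclotomic_class[of x "q ^ 2" y]
      by simp
    then show ?thesis
      unfolding classes_type_II'_def cyclotomic_classes_def I' Q by blast
  qed
  have "r_I' = (\<Sum>d | d dvd N. lambda d q *
      (real (card (elements_of_order A d)) / real (ord d (q ^ 2))))"
    using A.card_cyclotomic_classes_by_order[OF assms(4) coN2, of P] assms(5,6) I' lam by simp
  \<comment> \<open>The negated predicate has indicator \<open>1 - lambda d q\<close>; halving this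
    equation gives the factor 1/2 in the claim.\<close>
  moreover have "2 * r_II' = (\<Sum>d | d dvd N. (1 - lambda d q) *
      (real (card (elements_of_order A d)) / real (ord d (q ^ 2))))"
    using A.card_cyclotomic_classes_by_order[OF assms(4) coN2, of "\<lambda>d. \<not> P d"] assms(5,7) II' lam
    by (simp add: of_bool_not_iff)
  ultimately show ?thesis
    unfolding Q by (simp flip: q_def)
qed

end
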